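(* Let $m\ge 1$, let $(p_i(n))_{n\ge 1}$, $1\le i\le m$, be sequences of nonnegative real numbers, and let $(\sigma_i(n))_{n\ge 1}$, $1\le i\le m$, be sequences of integers such that $\sigma_i(n)\ge n+1$ for all $n\ge 1$, $1\le i\le m$, and such that all the advances are bounded, i.e. each sequence $(\sigma_i(n)-n)_{n\ge 1}$ is bounded. If $$\liminf_{n\to\infty}\sum_{i=1}^{m}\sum_{j=n+1}^{\sigma_k(n)}p_i(j)>\frac1e,\qquad k=1,\dots,m,$$ then all solutions of the difference equation $$\nabla x(n)-\sum_{i=1}^m p_i(n)\,x(\sigma_i(n))=0,\qquad n\ge 1,$$ oscillate.
   Context: $\nabla x(n)=x(n)-x(n-1)$. A solution of the equation is a real sequence $(x(n))_{n\ge 0}$ satisfying the equation for all $n\ge 1$. A solution is oscillatory (oscillates) if it is neither eventually positive nor eventually negative. *)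

theory Defs
  imports "HOL-Analysis.Analysis"
begin

text \<open>Sequences indexed by \<open>n \<ge> 1\<close> are functions on \<open>nat\<close> whose value at \<open>0\<close> is never used;
  the index \<open>i\<close> of the coefficients and deviating arguments ranges over \<open>{1..m}\<close>.\<close>

definition nabla :: "(nat \<Rightarrow> real) \<Rightarrow> nat \<Rightarrow> real" where
  "nabla x n = x n - x (n - 1)"

definition is_solution ::
  "nat \<Rightarrow> (nat \<Rightarrow> nat \<Rightarrow> real) \<Rightarrow> (nat \<Rightarrow> nat \<Rightarrow> nat) \<Rightarrow> (nat \<Rightarrow> real) \<Rightarrow> bool" where
  "is_solution m p \<sigma> x \<longleftrightarrow>
    (\<forall>n\<ge>1. nabla x n - (\<Sum>i=1..m. p i n * x (\<sigma> i n)) = 0)"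

definition oscillatory :: "(nat \<Rightarrow> real) \<Rightarrow> bool" where
  "oscillatory x \<longleftrightarrow>
    \<not> (\<forall>\<^sub>F n in sequentially. x n > 0) \<and> \<not> (\<forall>\<^sub>F n in sequentially. x n < 0)"

end

theory Submission imports Defs begin

text \<open>Let \<open>x\<close> be an eventually positive solution, \<open>P = p\<^sub>1 + \<dots> + p\<^sub>m\<close> and
  \<open>\<tau>(n) = min\<^sub>k \<sigma>\<^sub>k(n)\<close>. As \<open>x\<close> is eventually nondecreasing, \<open>P(n) x(\<tau>(n)) \<le> x(n) - x(n - 1)\<close>.
  If \<open>x(\<tau>(n)) \<ge> c x(n)\<close> for all \<open>n \<ge> N\<close>, then \<open>x(n - 1) \<le> (1 - c P(n)) x(n) \<le> exp (- c P(n)) x(n)\<close>;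
  multiplying this over \<open>n < j \<le> \<tau>(n)\<close>, where \<open>P\<close> has sum at least \<open>\<alpha> > 1/e\<close>, gives
  \<open>x(\<tau>(n)) \<ge> exp (\<alpha> c) x(n) \<ge> e \<alpha> c x(n)\<close> for all \<open>n \<ge> N\<close>, with the same \<open>N\<close>. Iterating, the
  fixed number \<open>x(\<tau>(N)) / x(N)\<close> exceeds every power of \<open>e \<alpha> > 1\<close>.\<close>

text \<open>The right end \<open>l\<close> is kept free for the induction. The factor
  \<open>c\<close> is any real; \<open>c = 0\<close> yields mere monotonicity.\<close>

lemma advanced_growth:
  fixes P x :: "nat \<Rightarrow> real" and \<tau> :: "nat \<Rightarrow> nat" and c :: real
  assumes pos: "\<And>n. n \<ge> N \<Longrightarrow> x n > 0"
    and P: "\<And>n. n > N \<Longrightarrow> P n \<ge> 0"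
    and ineq: "\<And>n. n > N \<Longrightarrow> P n * x (\<tau> n) \<le> x n - x (n - 1)"
    and ratio: "\<And>n. n > N \<Longrightarrow> c * x n \<le> x (\<tau> n)"
    and "N \<le> n" "n \<le> l"
  shows "x n * exp (c * (\<Sum>j=n+1..l. P j)) \<le> x l"
  using \<open>n \<le> l\<close>
proof (induction l rule: dec_induct)
  case base
  then show ?case by simp
next
  case (step l)
  have l: "Suc l > N" using step.hyps \<open>N \<le> n\<close> by simp
  have "P (Suc l) * (c * x (Suc l)) \<le> P (Suc l) * x (\<tau> (Suc l))"
    using P[OF l] ratio[OF l] by (rule mult_left_mono[rotated])
  then have "x l \<le> x (Suc l) * (1 + - (c * P (Suc l)))"
    using ineq[OF l] by (simp add: algebra_simps)
  \<comment> \<open>\<open>1 + y \<le> exp y\<close> holds for every real \<open>y\<close>, so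
    \<open>c * P (Suc l)\<close> may exceed 1.\<close>
  also have "\<dots> \<le> x (Suc l) * exp (- (c * P (Suc l)))"
    using pos[of "Suc l"] l by (intro mult_left_mono exp_ge_add_one_self) auto
  finally have "x l * exp (c * P (Suc l)) \<le> x (Suc l)"
    by (simp add: exp_minus field_simps)
  moreover have "x n * exp (c * (\<Sum>j=n+1..Suc l. P j))
      = x n * exp (c * (\<Sum>j=n+1..l. P j)) * exp (c * P (Suc l))"
    using step.hyps by (simp add: distrib_left exp_add mult.assoc)
  moreover have "\<dots> \<le> x l * exp (c * P (Suc l))"
    using step.IH by (rule mult_right_mono) simp
  ultimately show ?case by linarith
qed

text \<open>The graph of \<open>exp\<close> lies above its tangent at 1, which passes through the
  origin. This is the source of the constant 1/e.\<close>

lemma exp_one_mult_le_exp: "exp 1 * y \<le> exp (y::real)"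
proof -
  have "exp 1 * y \<le> exp 1 * exp (y - 1)"
    using exp_ge_add_one_self[of "y - 1"] by simp
  also have "\<dots> = exp y" by (simp flip: exp_add)
  finally show ?thesis .
qed

lemma advanced_inequality_no_positive_solution:
  fixes P x :: "nat \<Rightarrow> real" and \<tau> :: "nat \<Rightarrow> nat" and \<alpha> :: real
  assumes pos: "\<And>n. n \<ge> N \<Longrightarrow> x n > 0"
    and P: "\<And>n. n > N \<Longrightarrow> P n \<ge> 0"
    and \<tau>: "\<And>n. n \<ge> N \<Longrightarrow> n \<le> \<tau> n"
    and ineq: "\<And>n. n > N \<Longrightarrow> P n * x (\<tau> n) \<le> x n - x (n - 1)"
    and sum: "\<And>n. n \<ge> N \<Longrightarrow> \<alpha> \<le> (\<Sum>j=n+1..\<tau> n. P j)"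
    and \<alpha>: "1 / exp 1 < \<alpha>"
  shows False
proof -
  have gt1: "exp 1 * \<alpha> > 1" using \<alpha> by (simp add: field_simps)
  \<comment> \<open>Quantified over all \<open>n\<close> from \<open>N\<close> on, since the next
    power at \<open>n\<close> uses the current one at each index in
    \<open>{n+1..\<tau> n}\<close>.\<close>
  have "(exp 1 * \<alpha>) ^ k * x n \<le> x (\<tau> n)" if "n \<ge> N" for k n
    using that
  proof (induction k arbitrary: n)
    case 0
    \<comment> \<open>With \<open>c = 0\<close> the ratio hypothesis is just positivity.\<close>
    have "0 * x n \<le> x (\<tau> n)" if "n > N" for n
      using pos[of "\<tau> n"] \<tau>[of n] that by simp
    from advanced_growth[of N x P \<tau> 0 n "\<tau> n", OF pos P ineq this 0 \<tau>[OF 0]]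
    show ?case by simp
  next
    case (Suc k)
    let ?c = "(exp 1 * \<alpha>) ^ k"
    have c: "?c > 0" using gt1 by simp
    have "exp 1 * \<alpha> * ?c \<le> exp (?c * \<alpha>)"
      using exp_one_mult_le_exp[of "?c * \<alpha>"] by (simp add: mult_ac)
    also have "\<dots> \<le> exp (?c * (\<Sum>j=n+1..\<tau> n. P j))"
      using sum[OF Suc.prems] c by simp
    finally have "exp 1 * \<alpha> * ?c * x n \<le> x n * exp (?c * (\<Sum>j=n+1..\<tau> n. P j))"
      using pos[OF Suc.prems] by (simp add: mult.commute)
    also have "\<dots> \<le> x (\<tau> n)"
      using advanced_growth[of N x P \<tau> ?c n "\<tau> n", OF pos P ineq _ Suc.prems \<tau>[OF Suc.prems]]
        Suc.IH by simp
    finally show ?case by simp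
  qed
  then have "(exp 1 * \<alpha>) ^ k \<le> x (\<tau> N) / x N" for k
    using pos[of N] by (simp add: pos_le_divide_eq)
  moreover obtain k where "x (\<tau> N) / x N < (exp 1 * \<alpha>) ^ k"
    using real_arch_pow[OF gt1] by blast
  ultimately show False by (meson not_le)
qed

text \<open>The least of finitely many lower limits still exceeds \<open>b\<close>, so a real
  \<open>a\<close> fits strictly between. The strict gap later makes the growth factor exceed
  1.\<close>

lemma finite_liminf_gt_imp_eventually_gt:
  fixes f :: "'k \<Rightarrow> nat \<Rightarrow> real" and b :: real
  assumes "finite K" "K \<noteq> {}"
    and "\<And>k. k \<in> K \<Longrightarrow> liminf (\<lambda>n. ereal (f k n)) > ereal b"
  shows "\<exists>a>b. \<forall>\<^sub>F n in sequentially. \<forall>k\<in>K. a < f k n"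
proof -
  have "ereal b < Min ((\<lambda>k. liminf (\<lambda>n. ereal (f k n))) ` K)"
    using assms by simp
  then obtain a where a: "ereal b < ereal a"
      "ereal a < Min ((\<lambda>k. liminf (\<lambda>n. ereal (f k n))) ` K)"
    using ereal_dense2 by blast
  have "\<forall>\<^sub>F n in sequentially. a < f k n" if "k \<in> K" for k
  proof -
    have "ereal a < liminf (\<lambda>n. ereal (f k n))"
      using a(2) assms(1,2) that by simp
    from less_LiminfD[OF this] show ?thesis by simp
  qed
  then show ?thesis
    using a(1) assms(1) by (auto simp add: eventually_ball_finite)
qed

text \<open>Reduces the equation to the inequality with one advance: for nondecreasing
  \<open>x\<close>, replacing each \<open>\<sigma> i n\<close> by the smallest one only lowers the
  sum.\<close>

lemma no_eventually_positive_solution: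
  fixes p :: "nat \<Rightarrow> nat \<Rightarrow> real" and \<sigma> :: "nat \<Rightarrow> nat \<Rightarrow> nat"
  assumes m: "m \<ge> 1"
    and p: "\<And>i n. i \<in> {1..m} \<Longrightarrow> n \<ge> 1 \<Longrightarrow> p i n \<ge> 0"
    and \<sigma>: "\<And>i n. i \<in> {1..m} \<Longrightarrow> n \<ge> 1 \<Longrightarrow> \<sigma> i n \<ge> n + 1"
    and lim: "\<And>k. k \<in> {1..m} \<Longrightarrow>
           liminf (\<lambda>n. ereal (\<Sum>i=1..m. \<Sum>j=n+1..\<sigma> k n. p i j)) > ereal (1 / exp 1)"
    and sol: "is_solution m p \<sigma> x"
  shows "\<not> (\<forall>\<^sub>F n in sequentially. x n > 0)"
proof
  assume "\<forall>\<^sub>F n in sequentially. x n > 0"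
  moreover obtain \<alpha> where \<alpha>: "1 / exp 1 < \<alpha>"
    and "\<forall>\<^sub>F n in sequentially. \<forall>k\<in>{1..m}. \<alpha> < (\<Sum>i=1..m. \<Sum>j=n+1..\<sigma> k n. p i j)"
    using finite_liminf_gt_imp_eventually_gt[of "{1..m}" "1 / exp 1"
      "\<lambda>k n. \<Sum>i=1..m. \<Sum>j=n+1..\<sigma> k n. p i j", OF _ _ lim] m
    by (auto simp del: One_nat_def)
  ultimately have "\<forall>\<^sub>F n in sequentially. n \<ge> 1 \<and> x n > 0 \<and>
      (\<forall>k\<in>{1..m}. \<alpha> < (\<Sum>i=1..m. \<Sum>j=n+1..\<sigma> k n. p i j))"
    using eventually_ge_at_top[of "1::nat"] by (auto simp: eventually_conj_iff)
  then obtain N where N: "\<And>n. n \<ge> N \<Longrightarrow> n \<ge> 1" and pos: "\<And>n. n \<ge> N \<Longrightarrow> x n > 0"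
    and sum: "\<And>n k. n \<ge> N \<Longrightarrow> k \<in> {1..m} \<Longrightarrow> \<alpha> < (\<Sum>i=1..m. \<Sum>j=n+1..\<sigma> k n. p i j)"
    unfolding eventually_sequentially by blast
  define P where "P n = (\<Sum>i=1..m. p i n)" for n
  define \<tau> where "\<tau> n = Min ((\<lambda>i. \<sigma> i n) ` {1..m})" for n
  have \<tau>_le: "\<tau> n \<le> \<sigma> i n" if "i \<in> {1..m}" for i n
    unfolding \<tau>_def using that by (intro Min_le) auto
  \<comment> \<open>The minimising \<open>k\<close> may change with \<open>n\<close>, so the sum
    bound is used for all \<open>k\<close> at once.\<close>
  have \<tau>_attained: "\<exists>k\<in>{1..m}. \<tau> n = \<sigma> k n" for n
  proof -
    have "\<tau> n \<in> (\<lambda>i. \<sigma> i n) ` {1..m}"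
      unfolding \<tau>_def using m by (intro Min_in) auto
    then show ?thesis by blast
  qed
  have \<tau>: "n \<le> \<tau> n" if "n \<ge> N" for n
    using \<tau>_attained[of n] \<sigma>[OF _ N[OF that]] by fastforce
  have diff: "x n - x (n - 1) = (\<Sum>i=1..m. p i n * x (\<sigma> i n))" if "n \<ge> N" for n
    using sol N[OF that] unfolding is_solution_def nabla_def by fastforce
  have mono: "x n \<le> x l" if "N \<le> n" "n \<le> l" for n l
    using that(2)
  proof (induction l rule: dec_induct)
    case (step l)
    have l: "N \<le> Suc l" using step.hyps that(1) by simp
    \<comment> \<open>Advanced arguments stay beyond \<open>N\<close>, where \<open>x\<close> is
      positive.\<close>
    have "0 \<le> p i (Suc l) * x (\<sigma> i (Suc l))" if "i \<in> {1..m}" for i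
      using p[OF that, of "Suc l"] pos[of "\<sigma> i (Suc l)"] \<sigma>[OF that, of "Suc l"] l
      by simp
    then have "0 \<le> (\<Sum>i=1..m. p i (Suc l) * x (\<sigma> i (Suc l)))"
      by (rule sum_nonneg)
    then show ?case
      using diff[OF l] step.IH by simp
  qed simp
  show False
  proof (rule advanced_inequality_no_positive_solution[OF pos _ \<tau> _ _ \<alpha>])
    show "P n \<ge> 0" if "n > N" for n
      unfolding P_def using p N[of n] that by (intro sum_nonneg) auto
    show "P n * x (\<tau> n) \<le> x n - x (n - 1)" if "n > N" for n
    proof -
      have n: "n \<ge> N" "n \<ge> 1" using that by auto
      have "P n * x (\<tau> n) = (\<Sum>i=1..m. p i n * x (\<tau> n))"
        by (simp add: P_def sum_distrib_right)
      also have "\<dots> \<le> (\<Sum>i=1..m. p i n * x (\<sigma> i n))"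
        using \<tau>[OF n(1)] n \<tau>_le p by (intro sum_mono mult_left_mono mono) auto
      finally show ?thesis using diff[OF n(1)] by simp
    qed
    show "\<alpha> \<le> (\<Sum>j=n+1..\<tau> n. P j)" if "n \<ge> N" for n
    proof -
      obtain k where k: "k \<in> {1..m}" "\<tau> n = \<sigma> k n"
        using \<tau>_attained by blast
      show ?thesis
        using sum[OF that k(1)] unfolding k(2) P_def
        by (subst sum.swap) simp
    qed
  qed
qed

theorem theorem3:
  fixes m :: nat
    and p :: "nat \<Rightarrow> nat \<Rightarrow> real"
    and \<sigma> :: "nat \<Rightarrow> nat \<Rightarrow> nat"
  assumes "m \<ge> 1"
    and "\<And>i n. i \<in> {1..m} \<Longrightarrow> n \<ge> 1 \<Longrightarrow> p i n \<ge> 0"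
    and "\<And>i n. i \<in> {1..m} \<Longrightarrow> n \<ge> 1 \<Longrightarrow> \<sigma> i n \<ge> n + 1"
    and "\<And>i. i \<in> {1..m} \<Longrightarrow> bounded ((\<lambda>n. real (\<sigma> i n) - real n) ` {1..})"
    and "\<And>k. k \<in> {1..m} \<Longrightarrow>
           liminf (\<lambda>n. ereal (\<Sum>i=1..m. \<Sum>j=n+1..\<sigma> k n. p i j)) > ereal (1 / exp 1)"
  shows "\<forall>x. is_solution m p \<sigma> x \<longrightarrow> oscillatory x"
proof (intro allI impI)
  fix x
  assume sol: "is_solution m p \<sigma> x"
  \<comment> \<open>The equation is linear and homogeneous, so an eventually negative
    \<open>x\<close> is excluded through \<open>-x\<close>.\<close>
  then have neg: "is_solution m p \<sigma> (\<lambda>n. - x n)"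
    unfolding is_solution_def nabla_def by (auto simp: sum_negf algebra_simps)
  show "oscillatory x"
    using no_eventually_positive_solution[OF assms(1-3,5) sol]
      no_eventually_positive_solution[OF assms(1-3,5) neg]
    unfolding oscillatory_def by simp
qed

end
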